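(* Let $\mathcal{A}$ be a Fréchet algebra with unit, let $P:\mathbb{R}\to\mathcal{A}$ be a smooth path and $L(0)\in\mathcal{A}$. Then the equation $$\partial_t L_q(t)=[P_q(t),L_q(t)],\qquad L_q(0)=L(0),$$ has a unique solution in $\mathcal{A}[[q]]$, with explicit expression $$L_q(t)=\exp(P_q)(t)\cdot L(0)\cdot\big(\exp(P_q)(t)\big)^{-1}.$$
   Context: Here $P_q(t)=qP(qt)$ is the time-scaled operator, obtained from $t\mapsto qt$; following the paper's convention, it is regarded as a degree-one monomial in the formal variable $q$ of $\mathcal{A}[[q]]$, with coefficient the smooth path $t\mapsto P(qt)\in\mathcal{A}$ for a fixed value of the scaling parameter. Solutions are smooth paths $t\mapsto L_q(t)\in\mathcal{A}[[q]]$, where smoothness is coefficientwise. $\mathcal{A}[[q]]_{>0}$ denotes the ideal of formal series of positive $q$-valuation. The exponential of paths in $\mathcal{A}[[q]]_{>0}$, with values in $\mathrm{Id}+\mathcal{A}[[q]]_{>0}$, is $$\exp(P_q)(t)=\sum_{i=0}^\infty\int_{t\ge s_1\ge\dots\ge s_i\ge0}P_q(s_1)\cdots P_q(s_i)\,ds_1\cdots ds_i .$$ *)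

theory Defs
  imports "HOL-Analysis.Analysis" "HOL-Computational_Algebra.Formal_Power_Series"
begin

section \<open>Fr\'echet algebras\<close>

definition (in real_vector) seminorm :: "('a \<Rightarrow> real) \<Rightarrow> bool" where
  "seminorm p \<longleftrightarrow>
     (\<forall>x. 0 \<le> p x) \<and>
     (\<forall>x y. p (x + y) \<le> p x + p y) \<and>
     (\<forall>c x. p (c *\<^sub>R x) = \<bar>c\<bar> * p x)"

text \<open>
  A Fr\'echet space: the topology is induced by a countable separating family of seminorms and
  is complete. Sequential completeness suffices, since such a topology is metrizable.
\<close>

class frechet_space = real_vector + topological_space +
  assumes frechet_seminorms:
    "\<exists>p :: nat \<Rightarrow> 'a \<Rightarrow> real.
       (\<forall>k. seminorm (p k)) \<and>
       (\<forall>U. open U \<longleftrightarrow>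
          (\<forall>x\<in>U. \<exists>n. \<exists>e>0. \<forall>y. (\<forall>k\<le>n. p k (y - x) < e) \<longrightarrow> y \<in> U)) \<and>
       (\<forall>x. (\<forall>k. p k x = 0) \<longrightarrow> x = 0) \<and>
       (\<forall>X :: nat \<Rightarrow> 'a.
          (\<forall>k. \<forall>e>0. \<exists>N. \<forall>m\<ge>N. \<forall>n\<ge>N. p k (X m - X n) < e) \<longrightarrow>
          (\<exists>l. X \<longlonglongrightarrow> l))"

text \<open>
  The product is jointly continuous. The seminorms need not be submultiplicative, so the algebra
  need not be locally multiplicatively convex. Complex Fr\'echet algebras are covered by
  restriction of scalars.
\<close>

class frechet_algebra_1 = frechet_space + real_algebra_1 + topological_semigroup_mult


section \<open>Smooth paths and integrals\<close>

text \<open>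
  The library's vector derivative and Henstock-Kurzweil integral need a normed codomain; the
  definitions below are the same ones for a topological vector space.
\<close>

definition has_path_derivative ::
    "(real \<Rightarrow> 'a::frechet_space) \<Rightarrow> 'a \<Rightarrow> real \<Rightarrow> bool" where
  "has_path_derivative f d t \<longleftrightarrow> ((\<lambda>s. (f s - f t) /\<^sub>R (s - t)) \<longlongrightarrow> d) (at t)"

definition smooth_path :: "(real \<Rightarrow> 'a::frechet_space) \<Rightarrow> bool" where
  "smooth_path f \<longleftrightarrow>
     (\<exists>D :: nat \<Rightarrow> real \<Rightarrow> 'a.
        D 0 = f \<and> (\<forall>n t. has_path_derivative (D n) (D (Suc n) t) t))"

definition has_path_integral ::
    "(real \<Rightarrow> 'a::frechet_space) \<Rightarrow> 'a \<Rightarrow> real \<Rightarrow> real \<Rightarrow> bool" where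
  "has_path_integral f y a b \<longleftrightarrow>
     ((\<lambda>D. \<Sum>(x, K)\<in>D. measure lborel K *\<^sub>R f x) \<longlongrightarrow> y) (division_filter {a..b})"

text \<open>The oriented integral from \<open>a\<close> to \<open>b\<close>.\<close>

definition path_integral :: "real \<Rightarrow> real \<Rightarrow> (real \<Rightarrow> 'a::frechet_space) \<Rightarrow> 'a" where
  "path_integral a b f =
     (if a \<le> b then THE y. has_path_integral f y a b
      else - (THE y. has_path_integral f y b a))"


section \<open>Paths of formal power series\<close>

definition fps_has_path_derivative ::
    "(real \<Rightarrow> 'a::frechet_algebra_1 fps) \<Rightarrow> 'a fps \<Rightarrow> real \<Rightarrow> bool" where
  "fps_has_path_derivative L D t \<longleftrightarrow>
     (\<forall>n. has_path_derivative (\<lambda>s. fps_nth (L s) n) (fps_nth D n) t)"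

definition fps_smooth_path :: "(real \<Rightarrow> 'a::frechet_algebra_1 fps) \<Rightarrow> bool" where
  "fps_smooth_path L \<longleftrightarrow> (\<forall>n. smooth_path (\<lambda>t. fps_nth (L t) n))"

definition fps_path_integral ::
    "real \<Rightarrow> real \<Rightarrow> (real \<Rightarrow> 'a::frechet_algebra_1 fps) \<Rightarrow> 'a fps" where
  "fps_path_integral a b F = Abs_fps (\<lambda>n. path_integral a b (\<lambda>s. fps_nth (F s) n))"

text \<open>
  \<open>simplex_integral i F t\<close> is the integral of \<open>F [s\<^sub>1, \<dots>, s\<^sub>i]\<close> over
  \<open>t \<ge> s\<^sub>1 \<ge> \<dots> \<ge> s\<^sub>i \<ge> 0\<close>, written as an iterated integral with
  \<open>s\<^sub>1\<close> outermost. For negative \<open>t\<close> the integrals are oriented.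
\<close>

fun simplex_integral ::
    "nat \<Rightarrow> (real list \<Rightarrow> 'a::frechet_algebra_1 fps) \<Rightarrow> real \<Rightarrow> 'a fps" where
  "simplex_integral 0 F t = F []"
| "simplex_integral (Suc i) F t =
     fps_path_integral 0 t (\<lambda>s. simplex_integral i (\<lambda>ss. F (s # ss)) s)"

text \<open>The infinite sum is taken in the library's \<open>q\<close>-adic topology on formal power series.\<close>

definition path_exp :: "(real \<Rightarrow> 'a::frechet_algebra_1 fps) \<Rightarrow> real \<Rightarrow> 'a fps" where
  "path_exp Q t = (\<Sum>i. simplex_integral i (\<lambda>ss. prod_list (map Q ss)) t)"


section \<open>The scaled Lax equation\<close>

text \<open>
  \<open>P\<^sub>q(t) = q P(qt)\<close>: the prefactor is the formal variable, while the \<open>q\<close> inside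
  the argument of \<open>P\<close> is a fixed value \<open>c\<close> of the scaling parameter.
\<close>

definition scaled_path ::
    "real \<Rightarrow> (real \<Rightarrow> 'a::frechet_algebra_1) \<Rightarrow> real \<Rightarrow> 'a fps" where
  "scaled_path c P t = fps_X * fps_const (P (c * t))"

definition lax_solution ::
    "(real \<Rightarrow> 'a::frechet_algebra_1 fps) \<Rightarrow> 'a \<Rightarrow> (real \<Rightarrow> 'a fps) \<Rightarrow> bool" where
  "lax_solution Q L0 L \<longleftrightarrow>
     fps_smooth_path L \<and>
     (\<forall>t. fps_has_path_derivative L (Q t * L t - L t * Q t) t) \<and>
     L 0 = fps_const L0"

end

theory Submission
  imports Defs
begin

text \<open>
  In $q$-degree $n+1$ the equation reads $\partial_t L_{n+1} = A L_n - L_n A$ with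
  \<open>A t = P (c * t)\<close>, and in degree $0$ it reads $\partial_t L_0 = 0$. Multiplication by $q$ thus
  turns the differential equation into a recursion on the degree in which every step is one
  integration. All series are formal in $q$, so no exponential series has to converge in the
  algebra.

  Uniqueness (\<open>lax_solution_unique\<close>): two solutions have, by induction on $n$, coefficients with the
  same derivative and the same initial value, and a path with derivative zero is constant.

  Existence (\<open>conjugate_lax_solution\<close>): let \<open>E = dyson_series A\<close> solve $E' = q A E$ and let
  \<open>F = inverse_dyson_series A\<close> solve $F' = - F q A$, both starting at $1$; the coefficients of both
  are obtained by repeated integration. The product rule shows that $E L(0) F$ solves the Lax
  equation. Moreover $(F E)' = - F q A E + F q A E = 0$, hence $F E = 1$. For $E F$ the same
  computation only gives $(E F)' = [q A, E F]$; but this is the Lax equation with initial value $1$,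
  which the constant path $1$ also solves, so $E F = 1$ by uniqueness. Finally the $i$-th
  simplex integral of the exponential is the monomial $q^i E_i$, because each factor $q A$ raises the
  degree by one and each integration undoes the derivative in $E_{i+1}' = A E_i$
  (\<open>path_exp_eq_dyson_series\<close>).

  What remains is calculus for paths in a Fr\'echet space. All of it is done one seminorm at a time.
  The estimate of Riemann sums behind the fundamental theorem of calculus
  (\<open>riemann_sum_close\<close>) gives the theorem itself, and also the mean value
  inequality. Completeness is used once, to obtain primitives of continuous paths
  (\<open>path_antiderivative_exists\<close>): a continuous path is the locally uniform limit of paths with
  values in a finite-dimensional space, whose primitives come from real integration, and these
  primitives converge by the mean value inequality.
\<close>

unbundle no vec_syntax and fps_syntax

section \<open>Topology of a Fr\'echet space in terms of seminorms\<close>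

text \<open>
  The properties that the class asserts of some family of seminorms. Naming them keeps
  the choice of one such family from being unfolded in later proofs.
\<close>

definition defining_seminorms :: "(nat \<Rightarrow> 'a::frechet_space \<Rightarrow> real) \<Rightarrow> bool" where
  "defining_seminorms p \<longleftrightarrow>
     (\<forall>k. seminorm (p k)) \<and>
     (\<forall>U. open U \<longleftrightarrow> (\<forall>x\<in>U. \<exists>n. \<exists>e>0. \<forall>y. (\<forall>k\<le>n. p k (y - x) < e) \<longrightarrow> y \<in> U)) \<and>
     (\<forall>x. (\<forall>k. p k x = 0) \<longrightarrow> x = 0) \<and>
     (\<forall>X. (\<forall>k. \<forall>e>0. \<exists>N. \<forall>m\<ge>N. \<forall>n\<ge>N. p k (X m - X n) < e) \<longrightarrow>
        (\<exists>l. X \<longlonglongrightarrow> l))"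

definition fnorm :: "nat \<Rightarrow> 'a::frechet_space \<Rightarrow> real" where
  "fnorm = (SOME p. defining_seminorms p)"

lemma defining_seminorms_fnorm: "defining_seminorms fnorm"
proof -
  have "\<exists>p. defining_seminorms p"
    unfolding defining_seminorms_def by (rule frechet_seminorms)
  then show ?thesis unfolding fnorm_def by (rule someI_ex)
qed

lemmas fnorm_spec = defining_seminorms_fnorm[unfolded defining_seminorms_def]

lemma fnorm_seminorm: "seminorm (fnorm k)"
  by (rule fnorm_spec[THEN conjunct1, THEN spec])

lemma open_fnorm_iff:
  "open U \<longleftrightarrow> (\<forall>x\<in>U. \<exists>n. \<exists>e>0. \<forall>y. (\<forall>k\<le>n. fnorm k (y - x) < e) \<longrightarrow> y \<in> U)"
  by (rule fnorm_spec[THEN conjunct2, THEN conjunct1, THEN spec])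

lemma fnorm_separating: "(\<And>k. fnorm k x = 0) \<Longrightarrow> x = 0"
  by (rule fnorm_spec[THEN conjunct2, THEN conjunct2, THEN conjunct1, THEN spec, THEN mp]) blast

lemma fnorm_complete:
  "(\<And>k e. e > 0 \<Longrightarrow> \<exists>N. \<forall>m\<ge>N. \<forall>n\<ge>N. fnorm k (X m - X n) < e) \<Longrightarrow> \<exists>l. X \<longlonglongrightarrow> l"
  by (rule fnorm_spec[THEN conjunct2, THEN conjunct2, THEN conjunct2, THEN spec, THEN mp]) blast

lemma fnorm_nonneg [simp]: "0 \<le> fnorm k x"
  and fnorm_triangle: "fnorm k (x + y) \<le> fnorm k x + fnorm k y"
  and fnorm_scaleR [simp]: "fnorm k (c *\<^sub>R x) = \<bar>c\<bar> * fnorm k x"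
  using fnorm_seminorm[of k] unfolding seminorm_def by blast+

lemma fnorm_zero [simp]: "fnorm k 0 = 0"
  using fnorm_scaleR[of k 0 0] by simp

lemma fnorm_minus [simp]: "fnorm k (- x) = fnorm k x"
  using fnorm_scaleR[of k "-1" x] by simp

lemma fnorm_minus_commute: "fnorm k (x - y) = fnorm k (y - x)"
  using fnorm_minus[of k "x - y"] by simp

lemma fnorm_diff: "fnorm k (x - y) \<le> fnorm k x + fnorm k y"
  using fnorm_triangle[of k x "- y"] by simp

lemma fnorm_diff_triangle: "fnorm k (x - z) \<le> fnorm k (x - y) + fnorm k (y - z)"
  using fnorm_triangle[of k "x - y" "y - z"] by simp

lemma fnorm_sum: "fnorm k (sum f A) \<le> (\<Sum>a\<in>A. fnorm k (f a))"
proof (induction A rule: infinite_finite_induct)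
  case (insert a A)
  then show ?case using fnorm_triangle[of k "f a" "sum f A"] by simp
qed simp_all

lemma open_fnorm_ball: "open {y. fnorm k (y - z) < e}"
  unfolding open_fnorm_iff
proof (rule ballI, unfold mem_Collect_eq)
  fix x assume x: "fnorm k (x - z) < e"
  show "\<exists>n. \<exists>d>0. \<forall>y. (\<forall>k\<le>n. fnorm k (y - x) < d) \<longrightarrow> fnorm k (y - z) < e"
  proof (intro exI[of _ k] exI[of _ "e - fnorm k (x - z)"] conjI allI impI)
    fix y assume "\<forall>j\<le>k. fnorm j (y - x) < e - fnorm k (x - z)"
    then have "fnorm k (y - x) < e - fnorm k (x - z)" by simp
    then show "fnorm k (y - z) < e"
      using fnorm_diff_triangle[of k y z x] by simp
  qed (use x in simp)
qed

text \<open>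
  The bridge between the topology and real analysis: a basic neighbourhood constrains only finitely
  many seminorms, so convergence may be tested on each seminorm separately.
\<close>

lemma tendsto_fnorm_iff:
  "(f \<longlongrightarrow> l) F \<longleftrightarrow> (\<forall>k. ((\<lambda>x. fnorm k (f x - l)) \<longlongrightarrow> 0) F)"
proof safe
  fix k assume lim: "(f \<longlongrightarrow> l) F"
  show "((\<lambda>x. fnorm k (f x - l)) \<longlongrightarrow> 0) F"
  proof (rule tendstoI)
    fix e :: real assume "e > 0"
    from lim open_fnorm_ball have "\<forall>\<^sub>F x in F. f x \<in> {y. fnorm k (y - l) < e}"
      by (rule topological_tendstoD) (simp add: \<open>e > 0\<close>)
    then show "\<forall>\<^sub>F x in F. dist (fnorm k (f x - l)) 0 < e"
      by simp
  qed
next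
  assume lim: "\<forall>k. ((\<lambda>x. fnorm k (f x - l)) \<longlongrightarrow> 0) F"
  show "(f \<longlongrightarrow> l) F"
  proof (rule topological_tendstoI)
    fix U assume "open U" "l \<in> U"
    then obtain n e where "e > 0" and ball: "\<And>y. (\<forall>k\<le>n. fnorm k (y - l) < e) \<Longrightarrow> y \<in> U"
      unfolding open_fnorm_iff by blast
    have "\<forall>\<^sub>F x in F. \<forall>k\<in>{..n}. fnorm k (f x - l) < e"
      unfolding eventually_ball_finite_distrib[OF finite_atMost]
      using lim \<open>e > 0\<close> order_tendstoD(2) by blast
    then show "\<forall>\<^sub>F x in F. f x \<in> U"
      by eventually_elim (auto intro: ball)
  qed
qed

lemma tendsto_fnorm_boundI:
  assumes "\<And>k. \<forall>\<^sub>F x in F. fnorm k (f x - l) \<le> g k x" "\<And>k. (g k \<longlongrightarrow> 0) F"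
  shows "(f \<longlongrightarrow> l) F"
  unfolding tendsto_fnorm_iff
  using assms by (auto intro!: tendsto_sandwich[OF _ assms(1) tendsto_const assms(2)])

instance frechet_space \<subseteq> t2_space
proof
  fix x y :: 'a assume "x \<noteq> y"
  then obtain k where "fnorm k (x - y) \<noteq> 0"
    using fnorm_separating[of "x - y"] by auto
  then have pos: "fnorm k (x - y) > 0" by (simp add: less_le)
  define r where "r = fnorm k (x - y) / 2"
  have "False" if "fnorm k (w - x) < r" "fnorm k (w - y) < r" for w
    using fnorm_diff_triangle[of k x y w] fnorm_minus_commute[of k w x] that by (simp add: r_def)
  then have disjoint: "{w. fnorm k (w - x) < r} \<inter> {w. fnorm k (w - y) < r} = {}"
    by blast
  show "\<exists>U V. open U \<and> open V \<and> x \<in> U \<and> y \<in> V \<and> U \<inter> V = {}"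
  proof (intro exI conjI)
    show "open {w. fnorm k (w - x) < r}" "open {w. fnorm k (w - y) < r}"
      by (rule open_fnorm_ball)+
  qed (use pos disjoint in \<open>simp_all add: r_def\<close>)
qed

instance frechet_space \<subseteq> topological_ab_group_add
proof
  fix a b :: 'a
  have a: "((\<lambda>x. fnorm k (fst x - a)) \<longlongrightarrow> 0) (nhds a \<times>\<^sub>F nhds b)"
    and b: "((\<lambda>x. fnorm k (snd x - b)) \<longlongrightarrow> 0) (nhds a \<times>\<^sub>F nhds b)" for k
    using tendsto_fnorm_iff[of fst a "nhds a \<times>\<^sub>F nhds b"]
      tendsto_fnorm_iff[of snd b "nhds a \<times>\<^sub>F nhds b"] filterlim_fst filterlim_snd by blast+
  show "((\<lambda>x. fst x + snd x) \<longlongrightarrow> a + b) (nhds a \<times>\<^sub>F nhds b)"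
  proof (rule tendsto_fnorm_boundI)
    fix k
    have "fnorm k (fst x + snd x - (a + b)) \<le> fnorm k (fst x - a) + fnorm k (snd x - b)" for x
      using fnorm_triangle[of k "fst x - a" "snd x - b"] by (simp add: algebra_simps)
    then show "\<forall>\<^sub>F x in nhds a \<times>\<^sub>F nhds b.
        fnorm k (fst x + snd x - (a + b)) \<le> fnorm k (fst x - a) + fnorm k (snd x - b)"
      by simp
    show "((\<lambda>x. fnorm k (fst x - a) + fnorm k (snd x - b)) \<longlongrightarrow> 0) (nhds a \<times>\<^sub>F nhds b)"
      using tendsto_add[OF a b] by simp
  qed
  have "((\<lambda>x. x) \<longlongrightarrow> a) (nhds a)" by (rule filterlim_ident)
  then have "((\<lambda>x. fnorm k (- x - - a)) \<longlongrightarrow> 0) (nhds a)" for k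
    unfolding tendsto_fnorm_iff by (simp add: fnorm_minus_commute)
  then show "(uminus \<longlongrightarrow> - a) (nhds a)"
    by (simp add: tendsto_fnorm_iff[of uminus])
qed

lemma frechet_tendsto_scaleR:
  fixes x :: "'b \<Rightarrow> 'a::frechet_space"
  assumes c: "(c \<longlongrightarrow> c0) F" and x: "(x \<longlongrightarrow> x0) F"
  shows "((\<lambda>t. c t *\<^sub>R x t) \<longlongrightarrow> c0 *\<^sub>R x0) F"
proof (rule tendsto_fnorm_boundI)
  fix k
  have "c t *\<^sub>R x t - c0 *\<^sub>R x0 = c t *\<^sub>R (x t - x0) + (c t - c0) *\<^sub>R x0" for t
    by (simp add: scaleR_diff_left scaleR_diff_right)
  then have "fnorm k (c t *\<^sub>R x t - c0 *\<^sub>R x0) \<le> \<bar>c t\<bar> * fnorm k (x t - x0) + \<bar>c t - c0\<bar> * fnorm k x0" for t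
    using fnorm_triangle[of k "c t *\<^sub>R (x t - x0)" "(c t - c0) *\<^sub>R x0"]
    by (simp only: fnorm_scaleR)
  then show "\<forall>\<^sub>F t in F. fnorm k (c t *\<^sub>R x t - c0 *\<^sub>R x0)
      \<le> \<bar>c t\<bar> * fnorm k (x t - x0) + \<bar>c t - c0\<bar> * fnorm k x0" by simp
  have "((\<lambda>t. fnorm k (x t - x0)) \<longlongrightarrow> 0) F"
    using x tendsto_fnorm_iff by blast
  from tendsto_add[OF tendsto_mult[OF tendsto_rabs[OF c] this]
      tendsto_mult[OF tendsto_rabs[OF tendsto_diff[OF c tendsto_const[of c0]]]
        tendsto_const[of "fnorm k x0"]]]
  show "((\<lambda>t. \<bar>c t\<bar> * fnorm k (x t - x0) + \<bar>c t - c0\<bar> * fnorm k x0) \<longlongrightarrow> 0) F"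
    by simp
qed

section \<open>Derivatives of paths\<close>

lemma fnorm_difference_quotient:
  assumes "s \<noteq> t"
  shows "fnorm k ((f s - f t) /\<^sub>R (s - t) - d) = fnorm k (f s - f t - (s - t) *\<^sub>R d) / \<bar>s - t\<bar>"
proof -
  have "(f s - f t) /\<^sub>R (s - t) - d = (f s - f t - (s - t) *\<^sub>R d) /\<^sub>R (s - t)"
    using assms by (simp add: scaleR_diff_right)
  then show ?thesis by (simp add: divide_inverse_commute del: scaleR_diff_right)
qed

text \<open>
  The form with error at most \<open>e * \<bar>s - t\<bar>\<close> also covers \<open>s = t\<close> and needs no division, which is
  what estimates of Riemann sums require.
\<close>

lemma has_path_derivative_iff:
  "has_path_derivative f d t \<longleftrightarrow>
     (\<forall>k. \<forall>e>0. \<exists>\<delta>>0. \<forall>s. \<bar>s - t\<bar> < \<delta> \<longrightarrow> fnorm k (f s - f t - (s - t) *\<^sub>R d) \<le> e * \<bar>s - t\<bar>)"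
  (is "_ \<longleftrightarrow> ?R")
proof
  assume "has_path_derivative f d t"
  then have lim: "((\<lambda>s. fnorm k ((f s - f t) /\<^sub>R (s - t) - d)) \<longlongrightarrow> 0) (at t)" for k
    unfolding has_path_derivative_def tendsto_fnorm_iff by blast
  show ?R
  proof (intro allI impI)
    fix k and e :: real assume "e > 0"
    then obtain \<delta> where "\<delta> > 0" and \<delta>:
      "\<And>s. s \<noteq> t \<Longrightarrow> \<bar>s - t\<bar> < \<delta> \<Longrightarrow> fnorm k ((f s - f t) /\<^sub>R (s - t) - d) < e"
      using tendstoD[OF lim[of k] \<open>e > 0\<close>] unfolding eventually_at by (auto simp: dist_real_def)
    have "fnorm k (f s - f t - (s - t) *\<^sub>R d) \<le> e * \<bar>s - t\<bar>" if "\<bar>s - t\<bar> < \<delta>" for s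
    proof (cases "s = t")
      case False
      then show ?thesis
        using \<delta>[OF False that] unfolding fnorm_difference_quotient[OF False]
        by (simp add: field_simps)
    qed simp
    then show "\<exists>\<delta>>0. \<forall>s. \<bar>s - t\<bar> < \<delta> \<longrightarrow> fnorm k (f s - f t - (s - t) *\<^sub>R d) \<le> e * \<bar>s - t\<bar>"
      using \<open>\<delta> > 0\<close> by blast
  qed
next
  assume R: ?R
  show "has_path_derivative f d t"
    unfolding has_path_derivative_def tendsto_fnorm_iff
  proof (intro allI tendstoI)
    fix k and e :: real assume "e > 0"
    with R obtain \<delta> where "\<delta> > 0" and \<delta>:
      "\<And>s. \<bar>s - t\<bar> < \<delta> \<Longrightarrow> fnorm k (f s - f t - (s - t) *\<^sub>R d) \<le> e / 2 * \<bar>s - t\<bar>"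
      by (meson half_gt_zero)
    have "fnorm k ((f s - f t) /\<^sub>R (s - t) - d) < e" if "s \<noteq> t" "\<bar>s - t\<bar> < \<delta>" for s
    proof -
      have "fnorm k (f s - f t - (s - t) *\<^sub>R d) / \<bar>s - t\<bar> \<le> e / 2"
        using \<delta>[OF that(2)] that(1) by (simp add: field_simps)
      then show ?thesis
        unfolding fnorm_difference_quotient[OF that(1)] using \<open>e > 0\<close> by linarith
    qed
    then show "\<forall>\<^sub>F s in at t. dist (fnorm k ((f s - f t) /\<^sub>R (s - t) - d)) 0 < e"
      unfolding eventually_at using \<open>\<delta> > 0\<close> by (auto simp: dist_real_def intro!: exI[of _ \<delta>])
  qed
qed

lemma has_path_derivative_const [simp]: "has_path_derivative (\<lambda>_. c) 0 t"
  by (simp add: has_path_derivative_def)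

lemma has_path_derivative_add:
  assumes "has_path_derivative f f' t" "has_path_derivative g g' t"
  shows "has_path_derivative (\<lambda>s. f s + g s) (f' + g') t"
proof -
  have "(f s + g s - (f t + g t)) /\<^sub>R (s - t) = (f s - f t) /\<^sub>R (s - t) + (g s - g t) /\<^sub>R (s - t)" for s
    by (simp add: algebra_simps)
  then show ?thesis
    using tendsto_add[OF assms[unfolded has_path_derivative_def]]
    by (simp add: has_path_derivative_def)
qed

lemma has_path_derivative_scaleR_left:
  assumes "(\<phi> has_real_derivative \<phi>') (at t)"
  shows "has_path_derivative (\<lambda>s. \<phi> s *\<^sub>R x) (\<phi>' *\<^sub>R x) t"
proof -
  have "((\<lambda>s. ((\<phi> s - \<phi> t) / (s - t)) *\<^sub>R x) \<longlongrightarrow> \<phi>' *\<^sub>R x) (at t)"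
    using assms by (intro frechet_tendsto_scaleR tendsto_const) (simp add: has_field_derivative_iff)
  then show ?thesis
    by (simp add: has_path_derivative_def scaleR_diff_left[symmetric] divide_inverse_commute)
qed

lemma has_path_derivative_minus:
  assumes "has_path_derivative f f' t"
  shows "has_path_derivative (\<lambda>s. - f s) (- f') t"
proof -
  have "(- f s - - f t) /\<^sub>R (s - t) = - ((f s - f t) /\<^sub>R (s - t))" for s
    by (simp add: algebra_simps)
  then show ?thesis
    using tendsto_minus[OF assms[unfolded has_path_derivative_def]]
    by (simp add: has_path_derivative_def)
qed

lemma has_path_derivative_diff:
  assumes "has_path_derivative f f' t" "has_path_derivative g g' t"
  shows "has_path_derivative (\<lambda>s. f s - g s) (f' - g') t"
  using has_path_derivative_add[OF assms(1) has_path_derivative_minus[OF assms(2)]] by simp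

lemma has_path_derivative_sum:
  assumes "\<And>i. i \<in> I \<Longrightarrow> has_path_derivative (f i) (f' i) t"
  shows "has_path_derivative (\<lambda>s. \<Sum>i\<in>I. f i s) (\<Sum>i\<in>I. f' i) t"
  using assms by (induction I rule: infinite_finite_induct) (auto intro: has_path_derivative_add)

lemma has_path_derivative_tendsto:
  assumes "has_path_derivative f d t"
  shows "(f \<longlongrightarrow> f t) (at t)"
proof -
  have "((\<lambda>s. (s - t) *\<^sub>R ((f s - f t) /\<^sub>R (s - t)) + f t) \<longlongrightarrow> (t - t) *\<^sub>R d + f t) (at t)"
    using assms unfolding has_path_derivative_def
    by (intro tendsto_add frechet_tendsto_scaleR tendsto_diff tendsto_const tendsto_ident_at)
  moreover have "\<forall>\<^sub>F s in at t. (s - t) *\<^sub>R ((f s - f t) /\<^sub>R (s - t)) + f t = f s"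
    by (auto simp: eventually_at_filter)
  ultimately show ?thesis
    by (simp cong: filterlim_cong add: tendsto_cong)
qed

lemma has_path_derivative_mult:
  fixes f g :: "real \<Rightarrow> 'a::frechet_algebra_1"
  assumes "has_path_derivative f f' t" "has_path_derivative g g' t"
  shows "has_path_derivative (\<lambda>s. f s * g s) (f' * g t + f t * g') t"
proof -
  have "((\<lambda>s. (f s - f t) /\<^sub>R (s - t) * g s + f t * ((g s - g t) /\<^sub>R (s - t)))
      \<longlongrightarrow> f' * g t + f t * g') (at t)"
    using assms has_path_derivative_tendsto[OF assms(2)] unfolding has_path_derivative_def
    by (intro tendsto_add tendsto_mult tendsto_const)
  moreover have "(f s - f t) /\<^sub>R (s - t) * g s + f t * ((g s - g t) /\<^sub>R (s - t))
      = (f s * g s - f t * g t) /\<^sub>R (s - t)" for s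
    by (simp add: algebra_simps)
  ultimately show ?thesis by (simp add: has_path_derivative_def)
qed


section \<open>Riemann sums, the fundamental theorem and the mean value inequality\<close>

text \<open>
  The increment is an additive function of the interval, so it telescopes over any division.
\<close>

lemma sum_increments_tagged_division:
  fixes f :: "real \<Rightarrow> 'a::ab_group_add"
  assumes "a \<le> b" "D tagged_division_of {a..b}"
  shows "(\<Sum>(x, K)\<in>D. f (Sup K) - f (Inf K)) = f b - f a"
proof -
  define g :: "real set \<Rightarrow> 'a" where "g K = (if K = {} then 0 else f (Sup K) - f (Inf K))" for K
  interpret operative_real plus 0 g
    rewrites "comm_monoid_set.F (+) 0 = sum"
    by standard[1] (auto simp: sum_def g_def)
  have "(\<Sum>(x, K)\<in>D. f (Sup K) - f (Inf K)) = (\<Sum>(x, K)\<in>D. g K)"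
    using assms(2) by (auto simp: g_def intro!: sum.cong)
  also have "\<dots> = g {a..b}"
    using tagged_division[of D a b] assms(2) by simp
  finally show ?thesis using assms(1) by (simp add: g_def)
qed

text \<open>
  On a small enough interval around its tag, the increment of \<open>f\<close> differs from the tangent value by
  at most \<open>e\<close> times the length. Summing these errors over a division gives \<open>e * (b - a)\<close>. The gauge
  depends on the seminorm.
\<close>

lemma riemann_sum_close:
  assumes deriv: "\<And>t. t \<in> {a..b} \<Longrightarrow> has_path_derivative f (f' t) t"
    and "a \<le> b" "e > 0"
  shows "\<forall>\<^sub>F D in division_filter {a..b}.
     fnorm k ((\<Sum>(x, K)\<in>D. measure lborel K *\<^sub>R f' x) - (f b - f a)) \<le> e * (b - a)"
proof -
  have "\<forall>t. \<exists>\<delta>>0. t \<in> {a..b} \<longrightarrow>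
      (\<forall>s. \<bar>s - t\<bar> < \<delta> \<longrightarrow> fnorm k (f s - f t - (s - t) *\<^sub>R f' t) \<le> e * \<bar>s - t\<bar>)"
    using deriv \<open>e > 0\<close> unfolding has_path_derivative_iff by (metis zero_less_one)
  then obtain \<delta> where pos: "\<And>t. \<delta> t > 0" and \<delta>:
    "\<And>t s. t \<in> {a..b} \<Longrightarrow> \<bar>s - t\<bar> < \<delta> t \<Longrightarrow>
        fnorm k (f s - f t - (s - t) *\<^sub>R f' t) \<le> e * \<bar>s - t\<bar>"
    by metis
  have "fnorm k ((\<Sum>(x, K)\<in>D. measure lborel K *\<^sub>R f' x) - (f b - f a)) \<le> e * (b - a)"
    if D: "D tagged_division_of {a..b}" and fine: "(\<lambda>x. ball x (\<delta> x)) fine D" for D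
  proof -
    have piece: "fnorm k (measure lborel K *\<^sub>R f' x - (f (Sup K) - f (Inf K)))
        \<le> e * (Sup K - Inf K)" if mem: "(x, K) \<in> D" for x K
    proof -
      obtain u v where K: "K = {u..v}"
        using tagged_division_ofD(4)[OF D mem] by auto
      have "x \<in> K" and sub: "K \<subseteq> {a..b}"
        using tagged_division_ofD(2,3)[OF D mem] by auto
      then have x: "u \<le> x" "x \<le> v" "x \<in> {a..b}" by (auto simp: K)
      have ball: "K \<subseteq> ball x (\<delta> x)" using fine mem by blast
      have "u \<in> K" "v \<in> K" using x by (auto simp: K)
      with ball have "u \<in> ball x (\<delta> x)" "v \<in> ball x (\<delta> x)" by blast+
      then have u: "fnorm k (f u - f x - (u - x) *\<^sub>R f' x) \<le> e * \<bar>u - x\<bar>"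
        and v: "fnorm k (f v - f x - (v - x) *\<^sub>R f' x) \<le> e * \<bar>v - x\<bar>"
        using \<delta>[OF x(3)] by (auto simp: dist_real_def abs_minus_commute)
      have split: "(v - u) *\<^sub>R f' x - (f v - f u)
          = (f u - f x - (u - x) *\<^sub>R f' x) - (f v - f x - (v - x) *\<^sub>R f' x)"
        by (simp add: scaleR_diff_left)
      have "fnorm k ((v - u) *\<^sub>R f' x - (f v - f u))
          \<le> fnorm k (f u - f x - (u - x) *\<^sub>R f' x) + fnorm k (f v - f x - (v - x) *\<^sub>R f' x)"
        unfolding split by (rule fnorm_diff)
      also have "\<dots> \<le> e * \<bar>u - x\<bar> + e * \<bar>v - x\<bar>"
        using u v by (rule add_mono)
      also have "\<dots> = e * (v - u)" using x by (simp add: algebra_simps)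
      finally show ?thesis using x by (simp add: K)
    qed
    have "(\<Sum>(x, K)\<in>D. measure lborel K *\<^sub>R f' x) - (f b - f a)
        = (\<Sum>(x, K)\<in>D. measure lborel K *\<^sub>R f' x - (f (Sup K) - f (Inf K)))"
      unfolding sum_increments_tagged_division[OF \<open>a \<le> b\<close> D, symmetric]
      by (simp add: sum_subtractf[symmetric] case_prod_unfold)
    then have "fnorm k ((\<Sum>(x, K)\<in>D. measure lborel K *\<^sub>R f' x) - (f b - f a))
        \<le> (\<Sum>(x, K)\<in>D. fnorm k (measure lborel K *\<^sub>R f' x - (f (Sup K) - f (Inf K))))"
      by (simp add: fnorm_sum case_prod_unfold)
    also have "\<dots> \<le> (\<Sum>(x, K)\<in>D. e * (Sup K - Inf K))"
      using piece by (intro sum_mono) auto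
    also have "\<dots> = e * (b - a)"
      using sum_increments_tagged_division[OF \<open>a \<le> b\<close> D, of "\<lambda>t. e * t"]
      by (simp add: right_diff_distrib)
    finally show ?thesis .
  qed
  moreover have "gauge (\<lambda>x. ball x (\<delta> x))"
    using pos by (simp add: gauge_ball_dependent)
  ultimately show ?thesis unfolding eventually_division_filter by blast
qed

lemma division_filter_real_neq_bot: "division_filter {a..b::real} \<noteq> bot"
  using division_filter_not_empty[of a b] by simp

text \<open>
  Uniqueness of the limit, needed to evaluate the definite description in the integral, holds
  because division filters are proper and the space is Hausdorff.
\<close>

lemma path_fundamental_theorem:
  assumes deriv: "\<And>t. has_path_derivative f (f' t) t"
  shows "path_integral a b f' = f b - f a"
proof -
  have main: "(THE y. has_path_integral f' y a b) = f b - f a" if "a \<le> b" for a b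
  proof -
    have "((\<lambda>D. \<Sum>(x, K)\<in>D. measure lborel K *\<^sub>R f' x) \<longlongrightarrow> f b - f a) (division_filter {a..b})"
      unfolding tendsto_fnorm_iff
    proof (intro allI tendstoI)
      fix k and e :: real assume "e > 0"
      have "e / (b - a + 1) > 0" using \<open>e > 0\<close> that by simp
      from riemann_sum_close[OF deriv that this, of k]
      show "\<forall>\<^sub>F D in division_filter {a..b}.
          dist (fnorm k ((\<Sum>(x, K)\<in>D. measure lborel K *\<^sub>R f' x) - (f b - f a))) 0 < e"
      proof eventually_elim
        case (elim D)
        have "e / (b - a + 1) * (b - a) < e"
          using \<open>e > 0\<close> that by (simp add: field_simps)
        with elim show ?case by simp
      qed
    qed
    then have "has_path_integral f' (f b - f a) a b" by (simp add: has_path_integral_def)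
    then show ?thesis
      unfolding has_path_integral_def
      by (intro the_equality) (auto intro: tendsto_unique[OF division_filter_real_neq_bot])
  qed
  show ?thesis
    using main[of a b] main[of b a] by (simp add: path_integral_def)
qed

text \<open>
  A Riemann sum of the derivative is bounded by \<open>B * (b - a)\<close> and may be chosen arbitrarily close to
  the increment of \<open>f\<close>.
\<close>

lemma path_mean_value_inequality:
  assumes deriv: "\<And>t. t \<in> {a..b} \<Longrightarrow> has_path_derivative f (f' t) t"
    and bound: "\<And>t. t \<in> {a..b} \<Longrightarrow> fnorm k (f' t) \<le> B"
    and "a \<le> b"
  shows "fnorm k (f b - f a) \<le> B * (b - a)"
proof -
  have "fnorm k (f b - f a) \<le> (B + e) * (b - a)" if "e > 0" for e
  proof -
    have "\<forall>\<^sub>F D in division_filter {a..b}. D tagged_division_of {a..b} \<and>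
        fnorm k ((\<Sum>(x, K)\<in>D. measure lborel K *\<^sub>R f' x) - (f b - f a)) \<le> e * (b - a)"
      using riemann_sum_close[OF deriv \<open>a \<le> b\<close> \<open>e > 0\<close>]
      by (intro eventually_conj eventually_division_filter_tagged_division) auto
    from eventually_happens'[OF division_filter_real_neq_bot this]
    obtain D where D: "D tagged_division_of {a..b}" and close:
      "fnorm k ((\<Sum>(x, K)\<in>D. measure lborel K *\<^sub>R f' x) - (f b - f a)) \<le> e * (b - a)"
      by blast
    let ?S = "\<Sum>(x, K)\<in>D. measure lborel K *\<^sub>R f' x"
    have "fnorm k ?S \<le> (\<Sum>(x, K)\<in>D. fnorm k (measure lborel K *\<^sub>R f' x))"
      unfolding case_prod_unfold by (rule fnorm_sum)
    also have "\<dots> \<le> (\<Sum>(x, K)\<in>D. B * measure lborel K)"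
    proof (intro sum_mono, clarify)
      fix x K assume "(x, K) \<in> D"
      then have "x \<in> {a..b}" using tagged_division_ofD(2,3)[OF D] by blast
      then show "fnorm k (measure lborel K *\<^sub>R f' x) \<le> B * measure lborel K"
        using mult_right_mono[OF bound measure_nonneg[of lborel K]] by (simp add: mult.commute)
    qed
    also have "\<dots> = B * (b - a)"
      using additive_content_tagged_division[of D a b] D \<open>a \<le> b\<close>
      by (simp add: case_prod_unfold sum_distrib_left[symmetric])
    finally have "fnorm k ?S \<le> B * (b - a)" .
    moreover have "fnorm k (f b - f a) \<le> fnorm k ?S + fnorm k (?S - (f b - f a))"
      using fnorm_diff[of k ?S "?S - (f b - f a)"] by simp
    ultimately show ?thesis using close by (simp add: algebra_simps)
  qed
  note * = this
  show ?thesis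
  proof (rule tendsto_lowerbound)
    show "((\<lambda>e. (B + e) * (b - a)) \<longlongrightarrow> B * (b - a)) (at_right 0)"
      by (auto intro!: tendsto_eq_intros)
    show "\<forall>\<^sub>F e in at_right 0. fnorm k (f b - f a) \<le> (B + e) * (b - a)"
      using * by (auto simp: eventually_at_filter)
  qed simp
qed

lemma path_mean_value_inequality_abs:
  assumes deriv: "\<And>t. has_path_derivative f (f' t) t"
    and bound: "\<And>t. t \<in> closed_segment a b \<Longrightarrow> fnorm k (f' t) \<le> B"
  shows "fnorm k (f b - f a) \<le> B * \<bar>b - a\<bar>"
proof (cases "a \<le> b")
  case True
  then show ?thesis
    using path_mean_value_inequality[of a b f f' k B] assms by (simp add: closed_segment_eq_real_ivl)
next
  case False
  then show ?thesis
    using path_mean_value_inequality[of b a f f' k B] assms fnorm_minus_commute[of k "f a"]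
    by (simp add: closed_segment_eq_real_ivl split: if_splits)
qed

lemma path_zero_derivative_constant:
  assumes "\<And>t. has_path_derivative f 0 t"
  shows "f t = f s"
proof -
  have "fnorm k (f t - f s) = 0" for k
    using path_mean_value_inequality_abs[of f "\<lambda>_. 0" s t k 0] assms
      fnorm_nonneg[of k "f t - f s"] by simp
  then show ?thesis using fnorm_separating[of "f t - f s"] by simp
qed

section \<open>Primitives of continuous paths\<close>

lemma tendsto_fnorm:
  assumes "(f \<longlongrightarrow> l) F"
  shows "((\<lambda>x. fnorm k (f x)) \<longlongrightarrow> fnorm k l) F"
proof -
  have lim: "((\<lambda>x. fnorm k (f x - l)) \<longlongrightarrow> 0) F"
    using assms tendsto_fnorm_iff by blast
  have "norm (fnorm k (f x) - fnorm k l) \<le> fnorm k (f x - l)" for x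
    using fnorm_triangle[of k "f x - l" l] fnorm_triangle[of k "l - f x" "f x"]
      fnorm_minus_commute[of k l "f x"] by (simp add: abs_le_iff)
  then have "((\<lambda>x. fnorm k (f x) - fnorm k l) \<longlongrightarrow> 0) F"
    by (intro Lim_null_comparison[OF _ lim] always_eventually allI)
  then show ?thesis by (rule LIM_zero_cancel)
qed

lemma continuous_on_fnorm:
  assumes "continuous_on S f"
  shows "continuous_on S (\<lambda>x. fnorm k (f x))"
  using assms by (auto simp: continuous_on_def intro: tendsto_fnorm)

text \<open>
  For a fixed seminorm, the real function $(s,u) \mapsto p(f(s) - f(u))$ is uniformly continuous on
  the compact square $S \times S$, and it vanishes on the diagonal.
\<close>

lemma fnorm_uniformly_continuous_on_compact:
  fixes f :: "'b::metric_space \<Rightarrow> 'a::frechet_space"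
  assumes f: "continuous_on S f" and "compact S" and "e > 0"
  obtains \<delta> where "\<delta> > 0"
    "\<And>s u. s \<in> S \<Longrightarrow> u \<in> S \<Longrightarrow> dist s u < \<delta> \<Longrightarrow> fnorm k (f s - f u) < e"
proof -
  let ?h = "\<lambda>(s, u). fnorm k (f s - f u)"
  have "continuous_on (S \<times> S) ?h"
    unfolding case_prod_unfold
    by (intro continuous_on_fnorm continuous_on_diff continuous_on_compose2[OF f]
        continuous_on_fst continuous_on_snd continuous_on_id) auto
  then have "uniformly_continuous_on (S \<times> S) ?h"
    using \<open>compact S\<close> by (intro compact_uniformly_continuous compact_Times)
  then obtain \<delta> where "\<delta> > 0" and \<delta>:
    "\<And>z w. z \<in> S \<times> S \<Longrightarrow> w \<in> S \<times> S \<Longrightarrow> dist w z < \<delta> \<Longrightarrow> dist (?h w) (?h z) < e"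
    using \<open>e > 0\<close> unfolding uniformly_continuous_on_def by meson
  have "fnorm k (f s - f u) < e" if "s \<in> S" "u \<in> S" "dist s u < \<delta>" for s u
    using \<delta>[of "(u, u)" "(s, u)"] that by (simp add: dist_Pair_Pair)
  with \<open>\<delta> > 0\<close> show ?thesis by (rule that)
qed

text \<open>
  A normalized partition of unity \<open>\<phi>\<close> subordinate to a finite cover by intervals of radius \<open>\<delta>\<close>
  turns \<open>f\<close> into \<open>g = (\<Sum>u. \<phi> u *\<^sub>R f u)\<close>. Its values are convex combinations of nearby values of \<open>f\<close>,
  and its primitive is found by integrating the real functions \<open>\<phi> u\<close>.
\<close>

lemma approximation_with_primitive:
  fixes f :: "real \<Rightarrow> 'a::frechet_space"
  assumes "N > 0" "\<delta> > 0"
  shows "\<exists>F g. F 0 = 0 \<and> (\<forall>t. has_path_derivative F (g t) t) \<and>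
    (\<forall>t k B. \<bar>t\<bar> \<le> N \<longrightarrow> (\<forall>u. \<bar>u - t\<bar> < \<delta> \<longrightarrow> fnorm k (f u - f t) \<le> B) \<longrightarrow>
       fnorm k (g t - f t) \<le> B)"
proof -
  obtain T where "finite T" and cover: "{-N..N} \<subseteq> (\<Union>u\<in>T. ball u \<delta>)"
  proof (rule compactE_image)
    show "compact {-N..N}" by simp
    show "open (ball u \<delta>)" if "u \<in> {-N..N}" for u by simp
    show "{-N..N} \<subseteq> (\<Union>u\<in>{-N..N}. ball u \<delta>)" using \<open>\<delta> > 0\<close> by auto
  qed
  \<comment> \<open>Clamping the argument makes the weights continuous on the whole line: outside
    the interval the hat functions alone could all vanish.\<close>
  define c :: "real \<Rightarrow> real" where "c s = max (-N) (min N s)" for s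
  define w where "w u s = max 0 (\<delta> - \<bar>c s - u\<bar>)" for u s
  define W where "W s = (\<Sum>u\<in>T. w u s)" for s
  define \<phi> where "\<phi> u s = w u s / W s" for u s
  have w_nonneg: "w u s \<ge> 0" for u s by (simp add: w_def)
  have W_pos: "W s > 0" for s
  proof -
    have "c s \<in> {-N..N}" using \<open>N > 0\<close> by (simp add: c_def)
    then obtain u where "u \<in> T" "\<bar>c s - u\<bar> < \<delta>"
      using cover by (auto simp: dist_real_def abs_minus_commute)
    then show ?thesis
      unfolding W_def using \<open>finite T\<close> w_nonneg by (intro sum_pos2[of _ u]) (auto simp: w_def)
  qed
  have \<phi>_nonneg: "\<phi> u s \<ge> 0" for u s
    using w_nonneg[of u s] W_pos[of s] by (simp add: \<phi>_def)
  have \<phi>_sum: "(\<Sum>u\<in>T. \<phi> u s) = 1" for s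
    using W_pos[of s] by (simp add: \<phi>_def sum_divide_distrib[symmetric] W_def[symmetric])
  have "continuous_on UNIV (\<phi> u)" for u
    unfolding \<phi>_def W_def w_def c_def
    using W_pos[unfolded W_def w_def c_def] by (intro continuous_intros) (metis less_irrefl)
  then have "isCont (\<phi> u) s" for u s
    by (simp add: continuous_on_eq_continuous_at)
  then have "\<exists>\<Phi>. \<forall>s. (\<Phi> has_real_derivative \<phi> u s) (at s)" for u
    using einterval_antiderivative[of "-\<infinity>" "\<infinity>" "\<phi> u"]
    by (simp add: has_real_derivative_iff_has_vector_derivative)
  then obtain \<Phi> where \<Phi>: "\<And>u s. (\<Phi> u has_real_derivative \<phi> u s) (at s)"
    by metis
  define F where "F t = (\<Sum>u\<in>T. (\<Phi> u t - \<Phi> u 0) *\<^sub>R f u)" for t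
  define g where "g t = (\<Sum>u\<in>T. \<phi> u t *\<^sub>R f u)" for t
  have "((\<lambda>t. \<Phi> u t - \<Phi> u 0) has_real_derivative \<phi> u t) (at t)" for u t
    using DERIV_diff[OF \<Phi>[of u t] DERIV_const[of "\<Phi> u 0"]] by simp
  then have "has_path_derivative F (g t) t" for t
    unfolding F_def g_def by (intro has_path_derivative_sum has_path_derivative_scaleR_left)
  moreover have "fnorm k (g t - f t) \<le> B"
    if t: "\<bar>t\<bar> \<le> N" and B: "\<forall>u. \<bar>u - t\<bar> < \<delta> \<longrightarrow> fnorm k (f u - f t) \<le> B" for t k B
  proof -
    have ct: "c t = t" using t by (simp add: c_def)
    have "f t = (\<Sum>u\<in>T. \<phi> u t *\<^sub>R f t)"
      by (simp add: scaleR_sum_left[symmetric] \<phi>_sum)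
    then have "g t - f t = (\<Sum>u\<in>T. \<phi> u t *\<^sub>R (f u - f t))"
      by (simp add: g_def scaleR_diff_right sum_subtractf)
    then have "fnorm k (g t - f t) \<le> (\<Sum>u\<in>T. fnorm k (\<phi> u t *\<^sub>R (f u - f t)))"
      by (simp only: fnorm_sum)
    also have "\<dots> \<le> (\<Sum>u\<in>T. \<phi> u t * B)"
    proof (rule sum_mono)
      fix u
      show "fnorm k (\<phi> u t *\<^sub>R (f u - f t)) \<le> \<phi> u t * B"
      proof (cases "\<bar>u - t\<bar> < \<delta>")
        case True
        then show ?thesis using B \<phi>_nonneg[of u t] by (simp add: mult_left_mono)
      next
        case False
        then have "\<phi> u t = 0" by (simp add: \<phi>_def w_def ct abs_minus_commute)
        then show ?thesis by simp
      qed
    qed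
    also have "\<dots> = B" by (simp add: sum_distrib_right[symmetric] \<phi>_sum)
    finally show ?thesis .
  qed
  moreover have "F 0 = 0" by (simp add: F_def)
  ultimately show ?thesis by blast
qed

text \<open>
  The approximations for radius $1/(n+1)$ on $[-(n+1), n+1]$ converge to \<open>f\<close> uniformly on bounded
  intervals. By the mean value inequality their primitives are Cauchy at every point, and the
  difference quotients of the limit satisfy the estimate that makes \<open>f t\<close> the derivative.
\<close>

theorem path_antiderivative_exists:
  fixes f :: "real \<Rightarrow> 'a::frechet_space"
  assumes f: "continuous_on UNIV f"
  shows "\<exists>F. F 0 = 0 \<and> (\<forall>t. has_path_derivative F (f t) t)"
proof -
  have "\<exists>F g. F 0 = 0 \<and> (\<forall>t. has_path_derivative F (g t) t) \<and>
    (\<forall>t k B. \<bar>t\<bar> \<le> real (Suc n) \<longrightarrow>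
       (\<forall>u. \<bar>u - t\<bar> < inverse (real (Suc n)) \<longrightarrow> fnorm k (f u - f t) \<le> B) \<longrightarrow>
       fnorm k (g t - f t) \<le> B)" for n
    by (rule approximation_with_primitive) auto
  then obtain F g where F0: "\<And>n. F n 0 = 0"
    and F: "\<And>n t. has_path_derivative (F n) (g n t) t"
    and approx: "\<And>n t k B. \<bar>t\<bar> \<le> real (Suc n) \<Longrightarrow>
       (\<And>u. \<bar>u - t\<bar> < inverse (real (Suc n)) \<Longrightarrow> fnorm k (f u - f t) \<le> B) \<Longrightarrow>
       fnorm k (g n t - f t) \<le> B"
    by metis
  \<comment> \<open>The interval is enlarged by 1 because the approximation at \<open>t\<close> uses values of \<open>f\<close> at
    distance up to \<open>inverse (n + 1) \<le> 1\<close>.\<close>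
  have unif: "\<exists>n0. \<forall>n\<ge>n0. \<forall>t. \<bar>t\<bar> \<le> M \<longrightarrow> fnorm k (g n t - f t) \<le> e" if "e > 0" for k M e
  proof -
    obtain \<delta> where "\<delta> > 0" and \<delta>: "\<And>s u. s \<in> {-(M+1)..M+1} \<Longrightarrow> u \<in> {-(M+1)..M+1} \<Longrightarrow>
        dist s u < \<delta> \<Longrightarrow> fnorm k (f s - f u) < e"
      by (rule fnorm_uniformly_continuous_on_compact[OF continuous_on_subset[OF f subset_UNIV]
          compact_Icc \<open>e > 0\<close>, of "-(M+1)" "M+1" k]) blast
    obtain n1 where n1: "inverse (real (Suc n1)) < \<delta>"
      using reals_Archimedean[OF \<open>\<delta> > 0\<close>] by blast
    obtain n2 where n2: "M \<le> real n2" using real_arch_simple by blast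
    have "fnorm k (g n t - f t) \<le> e" if n: "n \<ge> max n1 n2" and t: "\<bar>t\<bar> \<le> M" for n t
    proof (rule approx)
      show "\<bar>t\<bar> \<le> real (Suc n)" using n n2 t by simp
      fix u assume u: "\<bar>u - t\<bar> < inverse (real (Suc n))"
      have "inverse (real (Suc n)) \<le> inverse (real (Suc n1))" "inverse (real (Suc n)) \<le> 1"
        using n by (auto intro: le_imp_inverse_le simp: inverse_le_1_iff)
      then have "\<bar>u - t\<bar> < \<delta>" "\<bar>u - t\<bar> < 1" using u n1 by linarith+
      moreover have "u \<in> {-(M+1)..M+1}" "t \<in> {-(M+1)..M+1}"
        using \<open>\<bar>u - t\<bar> < 1\<close> t by auto
      ultimately show "fnorm k (f u - f t) \<le> e"
        using \<delta>[of u t] by (simp add: dist_real_def less_imp_le)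
    qed
    then show ?thesis by blast
  qed
  have "\<exists>l. (\<lambda>n. F n t) \<longlonglongrightarrow> l" for t
  proof (rule fnorm_complete)
    fix k and e :: real assume "e > 0"
    \<comment> \<open>Both primitives contribute an error of at most \<open>e' * \<bar>t\<bar>\<close>; the summand 1 covers \<open>t = 0\<close>.\<close>
    define e' where "e' = e / (4 * (\<bar>t\<bar> + 1))"
    have "e' > 0" using \<open>e > 0\<close> by (simp add: e'_def)
    from unif[OF this, of "\<bar>t\<bar>" k] obtain n0 where
      n0: "\<And>n s. n \<ge> n0 \<Longrightarrow> \<bar>s\<bar> \<le> \<bar>t\<bar> \<Longrightarrow> fnorm k (g n s - f s) \<le> e'" by blast
    have "fnorm k (F m t - F n t) < e" if "m \<ge> n0" "n \<ge> n0" for m n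
    proof -
      have "fnorm k ((F m t - F n t) - (F m 0 - F n 0)) \<le> (2 * e') * \<bar>t - 0\<bar>"
      proof (rule path_mean_value_inequality_abs)
        show "has_path_derivative (\<lambda>s. F m s - F n s) (g m s - g n s) s" for s
          by (intro has_path_derivative_diff F)
        fix s assume "s \<in> closed_segment 0 t"
        then have "\<bar>s\<bar> \<le> \<bar>t\<bar>" by (auto simp: closed_segment_eq_real_ivl split: if_splits)
        then show "fnorm k (g m s - g n s) \<le> 2 * e'"
          using n0[of m s] n0[of n s] fnorm_diff_triangle[of k "g m s" "g n s" "f s"]
            fnorm_minus_commute[of k "f s" "g n s"] that by simp
      qed
      also have "\<dots> < e"
        using \<open>e > 0\<close> unfolding e'_def by (simp add: field_simps add_pos_nonneg)
      finally show ?thesis by (simp add: F0)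
    qed
    then show "\<exists>n0. \<forall>m\<ge>n0. \<forall>n\<ge>n0. fnorm k (F m t - F n t) < e" by blast
  qed
  then obtain G where G: "\<And>t. (\<lambda>n. F n t) \<longlonglongrightarrow> G t" by metis
  have "has_path_derivative G (f t) t" for t
    unfolding has_path_derivative_iff
  proof (intro allI impI)
    fix k and e :: real assume "e > 0"
    have "((\<lambda>s. fnorm k (f s - f t)) \<longlongrightarrow> 0) (at t)"
      using f tendsto_fnorm_iff[of f "f t" "at t"] by (auto simp: continuous_on_def)
    then have "\<forall>\<^sub>F s in at t. fnorm k (f s - f t) < e / 2"
      using \<open>e > 0\<close> by (intro order_tendstoD(2)[of _ 0]) auto
    then obtain \<delta> where "\<delta> > 0" and \<delta>0:
      "\<And>s. s \<noteq> t \<Longrightarrow> \<bar>s - t\<bar> < \<delta> \<Longrightarrow> fnorm k (f s - f t) < e / 2"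
      unfolding eventually_at by (auto simp: dist_real_def)
    have \<delta>: "fnorm k (f s - f t) \<le> e / 2" if "\<bar>s - t\<bar> < \<delta>" for s
      using \<delta>0[of s] that \<open>e > 0\<close> by (cases "s = t") auto
    have "fnorm k (G s - G t - (s - t) *\<^sub>R f t) \<le> e * \<bar>s - t\<bar>" if s: "\<bar>s - t\<bar> < \<delta>" for s
    proof -
      obtain n0 where n0: "\<And>n u. n \<ge> n0 \<Longrightarrow> \<bar>u\<bar> \<le> \<bar>t\<bar> + \<delta> \<Longrightarrow> fnorm k (g n u - f u) \<le> e / 2"
        using unif[of "e / 2" "\<bar>t\<bar> + \<delta>" k] \<open>e > 0\<close> by auto
      have step: "fnorm k (F n s - F n t - (s - t) *\<^sub>R f t) \<le> e * \<bar>s - t\<bar>" if "n \<ge> n0" for n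
      proof -
        \<comment> \<open>The mean value inequality is applied after subtracting the affine path with slope \<open>f t\<close>.\<close>
        have "fnorm k ((F n s - s *\<^sub>R f t) - (F n t - t *\<^sub>R f t)) \<le> e * \<bar>s - t\<bar>"
        proof (rule path_mean_value_inequality_abs)
          show "has_path_derivative (\<lambda>u. F n u - u *\<^sub>R f t) (g n u - 1 *\<^sub>R f t) u" for u
            by (intro has_path_derivative_diff has_path_derivative_scaleR_left F DERIV_ident)
          fix u assume "u \<in> closed_segment t s"
          then have "\<bar>u - t\<bar> < \<delta>" "\<bar>u\<bar> \<le> \<bar>t\<bar> + \<delta>"
            using s by (auto simp: closed_segment_eq_real_ivl split: if_splits)
          then show "fnorm k (g n u - 1 *\<^sub>R f t) \<le> e"
            using n0[OF that, of u] \<delta>[of u] fnorm_diff_triangle[of k "g n u" "f t" "f u"] by simp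
        qed
        then show ?thesis by (simp add: scaleR_diff_left algebra_simps)
      qed
      have "(\<lambda>n. fnorm k (F n s - F n t - (s - t) *\<^sub>R f t))
          \<longlonglongrightarrow> fnorm k (G s - G t - (s - t) *\<^sub>R f t)"
        by (intro tendsto_fnorm tendsto_diff G tendsto_const)
      then show ?thesis
        using step by (intro LIMSEQ_le_const2) blast+
    qed
    then show "\<exists>\<delta>>0. \<forall>s. \<bar>s - t\<bar> < \<delta> \<longrightarrow> fnorm k (G s - G t - (s - t) *\<^sub>R f t) \<le> e * \<bar>s - t\<bar>"
      using \<open>\<delta> > 0\<close> by blast
  qed
  moreover have "G 0 = 0"
    using G[of 0] by (simp add: F0 LIMSEQ_const_iff)
  ultimately show ?thesis by blast
qed

section \<open>Smooth paths\<close>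

text \<open>
  To prove smoothness it is enough to exhibit a class of paths closed under differentiation; the
  iterated derivatives need not be written down.
\<close>

lemma smooth_path_coinduct:
  assumes "f \<in> S"
    and "\<And>g. g \<in> S \<Longrightarrow> \<exists>g'\<in>S. \<forall>t. has_path_derivative g (g' t) t"
  shows "smooth_path f"
proof -
  obtain d where d: "\<And>g. g \<in> S \<Longrightarrow> d g \<in> S \<and> (\<forall>t. has_path_derivative g (d g t) t)"
    using assms(2) by metis
  have "(d ^^ n) f \<in> S" for n
    by (induction n) (use assms(1) d in auto)
  then show ?thesis
    unfolding smooth_path_def using d by (intro exI[of _ "\<lambda>n. (d ^^ n) f"]) simp
qed

lemma smooth_pathE:
  assumes "smooth_path f"
  obtains f' where "smooth_path f'" "\<And>t. has_path_derivative f (f' t) t"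
proof -
  obtain D where D: "D 0 = f" "\<And>n t. has_path_derivative (D n) (D (Suc n) t) t"
    using assms unfolding smooth_path_def by blast
  show thesis
  proof (rule that)
    show "smooth_path (D 1)"
      unfolding smooth_path_def using D(2) by (intro exI[of _ "\<lambda>n. D (Suc n)"]) simp
    show "has_path_derivative f (D 1 t) t" for t
      using D(2)[of 0 t] by (simp add: D(1))
  qed
qed

lemma smooth_path_primitive:
  assumes "smooth_path f'" "\<And>t. has_path_derivative f (f' t) t"
  shows "smooth_path f"
proof (rule smooth_path_coinduct)
  show "f \<in> insert f (Collect smooth_path)" by simp
  fix g assume "g \<in> insert f (Collect smooth_path)"
  then consider "g = f" | "smooth_path g" by blast
  then show "\<exists>g'\<in>insert f (Collect smooth_path). \<forall>t. has_path_derivative g (g' t) t"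
  proof cases
    case 1
    then show ?thesis using assms by blast
  next
    case 2
    then obtain g' where "smooth_path g'" "\<And>t. has_path_derivative g (g' t) t"
      by (rule smooth_pathE) blast
    then show ?thesis by blast
  qed
qed

lemma smooth_path_continuous:
  assumes "smooth_path f"
  shows "continuous_on UNIV f"
proof -
  obtain f' where "\<And>t. has_path_derivative f (f' t) t"
    using assms by (rule smooth_pathE) blast
  then show ?thesis
    by (auto simp: continuous_on_def intro: has_path_derivative_tendsto)
qed

lemma smooth_path_const: "smooth_path (\<lambda>_. x)"
proof (rule smooth_path_coinduct)
  show "(\<lambda>_. x) \<in> range (\<lambda>y _. y)" by blast
  fix g :: "real \<Rightarrow> 'a" assume "g \<in> range (\<lambda>y _. y)"
  then show "\<exists>g'\<in>range (\<lambda>y _. y). \<forall>t. has_path_derivative g (g' t) t"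
    by (auto intro!: exI[of _ 0])
qed

lemma has_path_derivative_rescale:
  assumes "has_path_derivative f d (c * t)"
  shows "has_path_derivative (\<lambda>s. f (c * s)) (c *\<^sub>R d) t"
  unfolding has_path_derivative_iff
proof (intro allI impI)
  fix k and e :: real assume "e > 0"
  then have "e / (\<bar>c\<bar> + 1) > 0" by simp
  with assms obtain \<delta> where "\<delta> > 0" and \<delta>: "\<And>s. \<bar>s - c * t\<bar> < \<delta> \<Longrightarrow>
      fnorm k (f s - f (c * t) - (s - c * t) *\<^sub>R d) \<le> e / (\<bar>c\<bar> + 1) * \<bar>s - c * t\<bar>"
    unfolding has_path_derivative_iff by meson
  have "fnorm k (f (c * s) - f (c * t) - (s - t) *\<^sub>R c *\<^sub>R d) \<le> e * \<bar>s - t\<bar>"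
    if "\<bar>s - t\<bar> < \<delta> / (\<bar>c\<bar> + 1)" for s
  proof -
    have scaled: "\<bar>c * s - c * t\<bar> = \<bar>c\<bar> * \<bar>s - t\<bar>"
      by (simp add: right_diff_distrib[symmetric] abs_mult)
    have "\<bar>c\<bar> * \<bar>s - t\<bar> \<le> (\<bar>c\<bar> + 1) * \<bar>s - t\<bar>"
      by (intro mult_right_mono) auto
    also have "\<dots> < \<delta>"
      using that by (simp add: pos_less_divide_eq mult.commute)
    finally have "fnorm k (f (c * s) - f (c * t) - (c * s - c * t) *\<^sub>R d)
        \<le> e / (\<bar>c\<bar> + 1) * (\<bar>c\<bar> * \<bar>s - t\<bar>)"
      using \<delta>[of "c * s"] unfolding scaled by simp
    also have "\<dots> = (\<bar>c\<bar> / (\<bar>c\<bar> + 1)) * (e * \<bar>s - t\<bar>)" by simp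
    also have "\<dots> \<le> 1 * (e * \<bar>s - t\<bar>)"
      using \<open>e > 0\<close> by (intro mult_right_mono) auto
    finally show ?thesis by (simp add: right_diff_distrib[symmetric] mult.commute)
  qed
  moreover have "\<delta> / (\<bar>c\<bar> + 1) > 0" using \<open>\<delta> > 0\<close> by simp
  ultimately show "\<exists>\<delta>>0. \<forall>s. \<bar>s - t\<bar> < \<delta> \<longrightarrow>
      fnorm k (f (c * s) - f (c * t) - (s - t) *\<^sub>R c *\<^sub>R d) \<le> e * \<bar>s - t\<bar>"
    by blast
qed

lemma has_path_derivative_scaleR_right:
  assumes "has_path_derivative f d t"
  shows "has_path_derivative (\<lambda>s. a *\<^sub>R f s) (a *\<^sub>R d) t"
proof -
  have "(a *\<^sub>R f s - a *\<^sub>R f t) /\<^sub>R (s - t) = a *\<^sub>R ((f s - f t) /\<^sub>R (s - t))" for s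
    by (simp add: scaleR_diff_right mult.commute)
  then show ?thesis
    using frechet_tendsto_scaleR[OF tendsto_const[of a] assms[unfolded has_path_derivative_def]]
    by (simp add: has_path_derivative_def)
qed

text \<open>
  The paths \<open>\<lambda>t. a *\<^sub>R g (c * t)\<close> are closed under differentiation, the factor \<open>a\<close> absorbing the
  powers of \<open>c\<close> produced by the chain rule.
\<close>

lemma smooth_path_rescale:
  assumes "smooth_path f"
  shows "smooth_path (\<lambda>t. f (c * t))"
proof (rule smooth_path_coinduct)
  let ?S = "{\<lambda>t. a *\<^sub>R g (c * t) | a g. smooth_path g}"
  show "(\<lambda>t. f (c * t)) \<in> ?S"
    using assms by (auto intro!: exI[of _ 1] exI[of _ f])
  fix h assume "h \<in> ?S"
  then obtain a g where h: "h = (\<lambda>t. a *\<^sub>R g (c * t))" and "smooth_path g" by blast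
  then obtain g' where g': "smooth_path g'" "\<And>t. has_path_derivative g (g' t) t"
    using smooth_pathE by metis
  show "\<exists>h'\<in>?S. \<forall>t. has_path_derivative h (h' t) t"
  proof (intro bexI allI)
    show "has_path_derivative h ((a * c) *\<^sub>R g' (c * t)) t" for t
      using has_path_derivative_scaleR_right[OF has_path_derivative_rescale[OF g'(2)[of "c * t"]], of a]
      by (simp add: h)
    show "(\<lambda>t. (a * c) *\<^sub>R g' (c * t)) \<in> ?S" using g'(1) by blast
  qed
qed

text \<open>
  The class to which coinduction is applied for products: the Leibniz rule leaves the products
  themselves but stays within their finite sums.
\<close>

inductive_set smooth_products :: "(real \<Rightarrow> 'a::frechet_algebra_1) set" where
  mult: "smooth_path f \<Longrightarrow> smooth_path g \<Longrightarrow> (\<lambda>t. f t * g t) \<in> smooth_products"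
| add: "f \<in> smooth_products \<Longrightarrow> g \<in> smooth_products \<Longrightarrow> (\<lambda>t. f t + g t) \<in> smooth_products"

lemma smooth_products_smooth:
  assumes "f \<in> smooth_products"
  shows "smooth_path f"
  using assms
proof (rule smooth_path_coinduct)
  fix g :: "real \<Rightarrow> 'a" assume "g \<in> smooth_products"
  then show "\<exists>g'\<in>smooth_products. \<forall>t. has_path_derivative g (g' t) t"
  proof induction
    case (mult f g)
    obtain f' where f': "smooth_path f'" "\<And>t. has_path_derivative f (f' t) t"
      using mult.hyps(1) by (rule smooth_pathE) blast
    obtain g' where g': "smooth_path g'" "\<And>t. has_path_derivative g (g' t) t"
      using mult.hyps(2) by (rule smooth_pathE) blast
    show ?case
    proof (intro bexI allI)
      show "has_path_derivative (\<lambda>t. f t * g t) (f' t * g t + f t * g' t) t" for t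
        by (intro has_path_derivative_mult f' g')
      show "(\<lambda>t. f' t * g t + f t * g' t) \<in> smooth_products"
        by (intro smooth_products.intros f' g' mult.hyps)
    qed
  next
    case (add f g)
    then obtain f' g' where "f' \<in> smooth_products" "g' \<in> smooth_products"
      "\<And>t. has_path_derivative f (f' t) t" "\<And>t. has_path_derivative g (g' t) t"
      by blast
    then show ?case
      by (intro bexI[of _ "\<lambda>t. f' t + g' t"] allI has_path_derivative_add smooth_products.intros)
  qed
qed

lemma smooth_path_mult:
  fixes f g :: "real \<Rightarrow> 'a::frechet_algebra_1"
  shows "smooth_path f \<Longrightarrow> smooth_path g \<Longrightarrow> smooth_path (\<lambda>t. f t * g t)"
  by (rule smooth_products_smooth, rule smooth_products.mult)

lemma smooth_path_minus:
  fixes f :: "real \<Rightarrow> 'a::frechet_algebra_1"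
  assumes "smooth_path f"
  shows "smooth_path (\<lambda>t. - f t)"
  using smooth_path_mult[OF smooth_path_const[of "- 1"] assms] by simp

lemma smooth_path_add:
  fixes f g :: "real \<Rightarrow> 'a::frechet_algebra_1"
  assumes "smooth_path f" "smooth_path g"
  shows "smooth_path (\<lambda>t. f t + g t)"
proof -
  have "(\<lambda>t. f t * 1 + g t * 1) \<in> smooth_products"
    by (intro smooth_products.intros assms smooth_path_const)
  then show ?thesis using smooth_products_smooth by force
qed

lemma smooth_path_sum:
  fixes f :: "'i \<Rightarrow> real \<Rightarrow> 'a::frechet_algebra_1"
  assumes "\<And>i. i \<in> I \<Longrightarrow> smooth_path (f i)"
  shows "smooth_path (\<lambda>t. \<Sum>i\<in>I. f i t)"
  using assms
  by (induction I rule: infinite_finite_induct) (auto intro: smooth_path_add smooth_path_const)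


section \<open>Paths of formal power series\<close>

lemma fps_has_path_derivative_mult:
  assumes "fps_has_path_derivative F F' t" "fps_has_path_derivative G G' t"
  shows "fps_has_path_derivative (\<lambda>s. F s * G s) (F' * G t + F t * G') t"
proof -
  have "has_path_derivative (\<lambda>s. \<Sum>i=0..n. F s $ i * G s $ (n - i))
      (\<Sum>i=0..n. F' $ i * G t $ (n - i) + F t $ i * G' $ (n - i)) t" for n
    using assms unfolding fps_has_path_derivative_def
    by (intro has_path_derivative_sum has_path_derivative_mult) auto
  then show ?thesis
    by (simp add: fps_has_path_derivative_def fps_mult_nth sum.distrib)
qed

lemma fps_has_path_derivative_const [simp]: "fps_has_path_derivative (\<lambda>_. c) 0 t"
  by (simp add: fps_has_path_derivative_def)

lemma fps_smooth_path_mult: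
  assumes "fps_smooth_path F" "fps_smooth_path G"
  shows "fps_smooth_path (\<lambda>t. F t * G t)"
  using assms unfolding fps_smooth_path_def fps_mult_nth
  by (auto intro!: smooth_path_sum smooth_path_mult)

lemma fps_path_zero_derivative_constant:
  assumes "\<And>t. fps_has_path_derivative F 0 t"
  shows "F t = F s"
proof (rule fps_ext)
  fix n
  show "F t $ n = F s $ n"
    using assms unfolding fps_has_path_derivative_def
    by (intro path_zero_derivative_constant) simp
qed


section \<open>The time-ordered exponential and its inverse\<close>

definition primitive :: "(real \<Rightarrow> 'a::frechet_space) \<Rightarrow> real \<Rightarrow> 'a" where
  "primitive f = (SOME F. F 0 = 0 \<and> (\<forall>t. has_path_derivative F (f t) t))"

lemma
  assumes "smooth_path f"
  shows primitive_0: "primitive f 0 = 0"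
    and has_path_derivative_primitive: "has_path_derivative (primitive f) (f t) t"
    and smooth_path_primitive_operator: "smooth_path (primitive f)"
proof -
  have *: "primitive f 0 = 0 \<and> (\<forall>t. has_path_derivative (primitive f) (f t) t)"
    unfolding primitive_def
    by (rule someI_ex[OF path_antiderivative_exists[OF smooth_path_continuous[OF assms]]])
  then show "primitive f 0 = 0" "has_path_derivative (primitive f) (f t) t" by auto
  show "smooth_path (primitive f)"
    using smooth_path_primitive[OF assms] * by blast
qed

text \<open>
  The iterated integrals $\int_{t \ge s_1 \ge \dots \ge s_n \ge 0} A(s_1) \cdots A(s_n)$, that is, the
  coefficients of the solution of $E' = q A E$, $E(0) = 1$.
\<close>

primrec dyson_coeff :: "(real \<Rightarrow> 'a::frechet_algebra_1) \<Rightarrow> nat \<Rightarrow> real \<Rightarrow> 'a" where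
  "dyson_coeff A 0 = (\<lambda>_. 1)"
| "dyson_coeff A (Suc n) = primitive (\<lambda>t. A t * dyson_coeff A n t)"

text \<open>
  The coefficients of the solution of $F' = - F q A$, $F(0) = 1$.
\<close>

primrec inverse_dyson_coeff :: "(real \<Rightarrow> 'a::frechet_algebra_1) \<Rightarrow> nat \<Rightarrow> real \<Rightarrow> 'a" where
  "inverse_dyson_coeff A 0 = (\<lambda>_. 1)"
| "inverse_dyson_coeff A (Suc n) = primitive (\<lambda>t. inverse_dyson_coeff A n t * - A t)"

definition dyson_series :: "(real \<Rightarrow> 'a::frechet_algebra_1) \<Rightarrow> real \<Rightarrow> 'a fps" where
  "dyson_series A t = Abs_fps (\<lambda>n. dyson_coeff A n t)"

definition inverse_dyson_series :: "(real \<Rightarrow> 'a::frechet_algebra_1) \<Rightarrow> real \<Rightarrow> 'a fps" where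
  "inverse_dyson_series A t = Abs_fps (\<lambda>n. inverse_dyson_coeff A n t)"


section \<open>The Lax equation\<close>

abbreviation monomial_path :: "(real \<Rightarrow> 'a::frechet_algebra_1) \<Rightarrow> real \<Rightarrow> 'a fps" where
  "monomial_path A t \<equiv> fps_X * fps_const (A t)"

lemma monomial_mult_nth:
  fixes F :: "'a::ring_1 fps"
  shows "(fps_X * fps_const a * F) $ n = (case n of 0 \<Rightarrow> 0 | Suc m \<Rightarrow> a * F $ m)"
  by (cases n) (simp_all add: mult.assoc)

lemma mult_monomial_nth:
  fixes F :: "'a::ring_1 fps"
  shows "(F * (fps_X * fps_const a)) $ n = (case n of 0 \<Rightarrow> 0 | Suc m \<Rightarrow> F $ m * a)"
proof -
  have "F * (fps_X * fps_const a) = F * fps_X * fps_const a"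
    by (simp only: mult.assoc)
  also have "\<dots> = fps_X * (F * fps_const a)"
    by (simp only: fps_mult_fps_X_commute[symmetric] mult.assoc)
  finally have "F * (fps_X * fps_const a) = fps_X * (F * fps_const a)" .
  then show ?thesis by (cases n) simp_all
qed

context
  fixes A :: "real \<Rightarrow> 'a::frechet_algebra_1"
  assumes smooth: "smooth_path A"
begin

lemma smooth_path_dyson_coeff: "smooth_path (dyson_coeff A n)"
proof (induction n)
  case (Suc n)
  then show ?case by (simp add: smooth_path_primitive_operator smooth_path_mult smooth)
qed (simp add: smooth_path_const)

lemma smooth_path_inverse_dyson_coeff: "smooth_path (inverse_dyson_coeff A n)"
proof (induction n)
  case (Suc n)
  then show ?case
    unfolding inverse_dyson_coeff.simps
    by (intro smooth_path_primitive_operator smooth_path_mult smooth_path_minus smooth)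
qed (simp add: smooth_path_const)

lemma has_path_derivative_dyson_coeff_Suc:
  "has_path_derivative (dyson_coeff A (Suc n)) (A t * dyson_coeff A n t) t"
  unfolding dyson_coeff.simps
  by (intro has_path_derivative_primitive smooth_path_mult smooth smooth_path_dyson_coeff)

lemma has_path_derivative_inverse_dyson_coeff_Suc:
  "has_path_derivative (inverse_dyson_coeff A (Suc n)) (inverse_dyson_coeff A n t * - A t) t"
  unfolding inverse_dyson_coeff.simps
  by (intro has_path_derivative_primitive smooth_path_mult smooth_path_minus smooth
      smooth_path_inverse_dyson_coeff)

lemma dyson_coeff_Suc_0: "dyson_coeff A (Suc n) 0 = 0"
  unfolding dyson_coeff.simps
  by (intro primitive_0 smooth_path_mult smooth smooth_path_dyson_coeff)

lemma inverse_dyson_coeff_Suc_0: "inverse_dyson_coeff A (Suc n) 0 = 0"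
  unfolding inverse_dyson_coeff.simps
  by (intro primitive_0 smooth_path_mult smooth_path_minus smooth smooth_path_inverse_dyson_coeff)

lemma dyson_series_0: "dyson_series A 0 = 1"
proof (rule fps_ext)
  show "dyson_series A 0 $ n = 1 $ n" for n
    by (cases n) (simp_all add: dyson_series_def dyson_coeff_Suc_0 del: dyson_coeff.simps(2))
qed

lemma inverse_dyson_series_0: "inverse_dyson_series A 0 = 1"
proof (rule fps_ext)
  show "inverse_dyson_series A 0 $ n = 1 $ n" for n
    by (cases n) (simp_all add: inverse_dyson_series_def inverse_dyson_coeff_Suc_0
        del: inverse_dyson_coeff.simps(2))
qed

lemma has_derivative_dyson_series:
  "fps_has_path_derivative (dyson_series A) (monomial_path A t * dyson_series A t) t"
  unfolding fps_has_path_derivative_def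
proof
  show "has_path_derivative (\<lambda>s. dyson_series A s $ n)
      ((monomial_path A t * dyson_series A t) $ n) t" for n
    using has_path_derivative_dyson_coeff_Suc
    by (cases n) (simp_all add: dyson_series_def monomial_mult_nth del: dyson_coeff.simps(2))
qed

lemma has_derivative_inverse_dyson_series:
  "fps_has_path_derivative (inverse_dyson_series A)
     (- (inverse_dyson_series A t * monomial_path A t)) t"
  unfolding fps_has_path_derivative_def
proof
  show "has_path_derivative (\<lambda>s. inverse_dyson_series A s $ n)
      ((- (inverse_dyson_series A t * monomial_path A t)) $ n) t" for n
    using has_path_derivative_inverse_dyson_coeff_Suc
    by (cases n) (simp_all add: inverse_dyson_series_def mult_monomial_nth
        del: inverse_dyson_coeff.simps(2))
qed

text \<open>
  The bracket with $q A$ sees only the coefficients of lower degree, so the degree-$n$ coefficients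
  are determined one after the other.
\<close>

lemma lax_solution_unique:
  assumes "lax_solution (monomial_path A) L0 L" "lax_solution (monomial_path A) L0 M"
  shows "L = M"
proof -
  have "\<forall>t. L t $ n = M t $ n" for n
  proof (induction n)
    case 0
    have deriv: "has_path_derivative (\<lambda>s. N s $ 0) 0 t"
      if "lax_solution (monomial_path A) L0 N" for N t
    proof -
      have "has_path_derivative (\<lambda>s. N s $ 0)
          ((monomial_path A t * N t - N t * monomial_path A t) $ 0) t"
        using that unfolding lax_solution_def fps_has_path_derivative_def by blast
      then show ?thesis by simp
    qed
    have "has_path_derivative (\<lambda>s. L s $ 0 - M s $ 0) 0 t" for t
      using has_path_derivative_diff[OF deriv[OF assms(1)] deriv[OF assms(2)], of t] by simp
    then have "L t $ 0 - M t $ 0 = L 0 $ 0 - M 0 $ 0" for t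
      by (rule path_zero_derivative_constant)
    then show ?case using assms by (simp add: lax_solution_def)
  next
    case (Suc n)
    have deriv: "has_path_derivative (\<lambda>s. N s $ Suc n) (A t * N t $ n - N t $ n * A t) t"
      if "lax_solution (monomial_path A) L0 N" for N t
    proof -
      have "has_path_derivative (\<lambda>s. N s $ Suc n)
          ((monomial_path A t * N t - N t * monomial_path A t) $ Suc n) t"
        using that unfolding lax_solution_def fps_has_path_derivative_def by blast
      then show ?thesis by (simp add: monomial_mult_nth mult_monomial_nth)
    qed
    have "has_path_derivative (\<lambda>s. L s $ Suc n - M s $ Suc n) 0 t" for t
      using has_path_derivative_diff[OF deriv[OF assms(1)] deriv[OF assms(2)], of t] Suc by simp
    then have "L t $ Suc n - M t $ Suc n = L 0 $ Suc n - M 0 $ Suc n" for t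
      by (rule path_zero_derivative_constant)
    then show ?case using assms by (simp add: lax_solution_def)
  qed
  then show ?thesis by (simp add: fun_eq_iff fps_eq_iff)
qed

lemma conjugate_lax_solution:
  "lax_solution (monomial_path A) L0
     (\<lambda>t. dyson_series A t * fps_const L0 * inverse_dyson_series A t)"
  unfolding lax_solution_def
proof (intro conjI allI)
  let ?E = "dyson_series A" and ?F = "inverse_dyson_series A" and ?Q = "monomial_path A"
  have "fps_smooth_path ?E" "fps_smooth_path ?F" "fps_smooth_path (\<lambda>_. fps_const L0)"
    by (simp_all add: fps_smooth_path_def dyson_series_def inverse_dyson_series_def
        smooth_path_dyson_coeff smooth_path_inverse_dyson_coeff smooth_path_const)
  then show "fps_smooth_path (\<lambda>t. ?E t * fps_const L0 * ?F t)"
    by (intro fps_smooth_path_mult)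
  show "?E 0 * fps_const L0 * ?F 0 = fps_const L0"
    by (simp add: dyson_series_0 inverse_dyson_series_0)
  fix t
  have "fps_has_path_derivative (\<lambda>t. ?E t * fps_const L0 * ?F t)
      ((?Q t * ?E t * fps_const L0 + ?E t * 0) * ?F t + ?E t * fps_const L0 * - (?F t * ?Q t)) t"
    by (intro fps_has_path_derivative_mult has_derivative_dyson_series
        has_derivative_inverse_dyson_series fps_has_path_derivative_const)
  then show "fps_has_path_derivative (\<lambda>t. ?E t * fps_const L0 * ?F t)
      (?Q t * (?E t * fps_const L0 * ?F t) - ?E t * fps_const L0 * ?F t * ?Q t) t"
    by (simp add: mult.assoc)
qed

lemma inverse_dyson_series_mult_dyson_series:
  "inverse_dyson_series A t * dyson_series A t = 1"
proof -
  let ?E = "dyson_series A" and ?F = "inverse_dyson_series A" and ?Q = "monomial_path A"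
  have "fps_has_path_derivative (\<lambda>t. ?F t * ?E t) 0 t" for t
    using fps_has_path_derivative_mult[OF has_derivative_inverse_dyson_series
        has_derivative_dyson_series, of t] by (simp add: mult.assoc)
  then have "?F t * ?E t = ?F 0 * ?E 0"
    by (rule fps_path_zero_derivative_constant)
  then show ?thesis by (simp add: dyson_series_0 inverse_dyson_series_0)
qed

text \<open>
  The derivative of $E F$ is the commutator $[q A, E F]$, which does not vanish formally. Instead,
  $E F$ and the constant $1$ are two solutions of the Lax equation with initial value $1$.
\<close>

lemma dyson_series_mult_inverse_dyson_series:
  "dyson_series A t * inverse_dyson_series A t = 1"
proof -
  have "lax_solution (monomial_path A) 1 (\<lambda>_. 1)"
    unfolding lax_solution_def fps_smooth_path_def by (simp add: smooth_path_const)
  from lax_solution_unique[OF conjugate_lax_solution this] show ?thesis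
    by (simp add: fun_eq_iff)
qed

text \<open>
  The recursion for simplex integrals passes the already chosen factor into the integrand from the
  left, so the induction needs a general left factor. A monomial \<open>fps_X ^ m * fps_const g\<close> is
  general enough, because $q$ is central.
\<close>

lemma simplex_integral_monomial:
  "simplex_integral i (\<lambda>ss. fps_X ^ m * fps_const g * prod_list (map (monomial_path A) ss)) t
     = fps_X ^ (m + i) * fps_const (g * dyson_coeff A i t)"
proof (induction i arbitrary: m g t)
  case 0
  then show ?case by simp
next
  case (Suc i)
  have absorb: "fps_X ^ m * fps_const g * (monomial_path A s * F)
      = fps_X ^ Suc m * fps_const (g * A s) * F" for s and F :: "'a fps"
  proof -
    have "fps_const g * (fps_X * (fps_const (A s) * F)) = fps_X * (fps_const g * (fps_const (A s) * F))"
      by (metis fps_mult_fps_X_commute mult.assoc)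
    then show ?thesis
      by (simp add: mult.assoc power_Suc2 del: power_Suc flip: fps_const_mult)
  qed
  have next_coeff: "path_integral 0 t (\<lambda>s. g * (A s * dyson_coeff A i s)) = g * dyson_coeff A (Suc i) t"
  proof -
    have "has_path_derivative (\<lambda>s. g * dyson_coeff A (Suc i) s) (g * (A s * dyson_coeff A i s)) s" for s
      using has_path_derivative_mult[OF has_path_derivative_const has_path_derivative_dyson_coeff_Suc]
      by simp
    from path_fundamental_theorem[OF this, of 0 t] show ?thesis
      by (simp add: dyson_coeff_Suc_0 del: dyson_coeff.simps(2))
  qed
  have zero: "path_integral 0 t (\<lambda>_. 0 :: 'a) = 0"
    using path_fundamental_theorem[of "\<lambda>_. 0 :: 'a" "\<lambda>_. 0"] by simp
  have "simplex_integral (Suc i)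
        (\<lambda>ss. fps_X ^ m * fps_const g * prod_list (map (monomial_path A) ss)) t
      = fps_path_integral 0 t
          (\<lambda>s. fps_X ^ (Suc m + i) * fps_const (g * A s * dyson_coeff A i s))"
    by (simp only: simplex_integral.simps list.map prod_list.Cons absorb Suc.IH)
  also have "\<dots> = fps_X ^ (m + Suc i) * fps_const (g * dyson_coeff A (Suc i) t)"
    by (rule fps_ext) (simp add: fps_path_integral_def fps_X_power_mult_nth next_coeff zero mult.assoc
        del: power_Suc dyson_coeff.simps(2))
  finally show ?case .
qed

text \<open>
  In each degree only one simplex integral contributes, so the partial sums are eventually constant
  in every coefficient.
\<close>

lemma path_exp_eq_dyson_series: "path_exp (monomial_path A) t = dyson_series A t"
proof -
  have term_eq: "simplex_integral i (\<lambda>ss. prod_list (map (monomial_path A) ss)) t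
      = fps_X ^ i * fps_const (dyson_coeff A i t)" for i
    using simplex_integral_monomial[of i 0 1 t] by simp
  have "(\<lambda>i. fps_X ^ i * fps_const (dyson_coeff A i t)) sums dyson_series A t"
    unfolding sums_def
  proof (rule tendsto_fpsI)
    fix n
    have "(\<Sum>i<N. fps_X ^ i * fps_const (dyson_coeff A i t)) $ n = dyson_series A t $ n"
      if "N > n" for N
    proof -
      have "(\<Sum>i<N. fps_X ^ i * fps_const (dyson_coeff A i t)) $ n
          = (\<Sum>i<N. if i = n then dyson_coeff A i t else 0)"
        unfolding fps_sum_nth by (intro sum.cong) (auto simp: fps_X_power_mult_nth)
      also have "\<dots> = dyson_series A t $ n"
        using that by (simp add: dyson_series_def)
      finally show ?thesis .
    qed
    then show "\<forall>\<^sub>F N in sequentially.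
        (\<Sum>i<N. fps_X ^ i * fps_const (dyson_coeff A i t)) $ n = dyson_series A t $ n"
      by (auto intro: eventually_mono[OF eventually_gt_at_top[of n]])
  qed
  then show ?thesis
    unfolding path_exp_def term_eq by (rule sums_unique[symmetric])
qed

end


theorem theorem2p1:
  fixes P :: "real \<Rightarrow> 'a::frechet_algebra_1"
    and L0 :: 'a
    and c :: real
  assumes "smooth_path P"
  shows "(\<exists>!L. lax_solution (scaled_path c P) L0 L) \<and>
         (\<forall>L. lax_solution (scaled_path c P) L0 L \<longrightarrow>
            (\<forall>t. \<exists>E'. path_exp (scaled_path c P) t * E' = 1 \<and>
                      E' * path_exp (scaled_path c P) t = 1 \<and>
                      L t = path_exp (scaled_path c P) t * fps_const L0 * E'))"
proof -
  define A where "A t = P (c * t)" for t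
  have Q: "scaled_path c P = monomial_path A"
    by (simp add: fun_eq_iff scaled_path_def A_def)
  have A: "smooth_path A"
    unfolding A_def using assms by (rule smooth_path_rescale)
  have sol: "lax_solution (monomial_path A) L0
      (\<lambda>t. dyson_series A t * fps_const L0 * inverse_dyson_series A t)"
    by (rule conjugate_lax_solution[OF A])
  show ?thesis
    unfolding Q path_exp_eq_dyson_series[OF A]
  proof (intro conjI allI impI)
    show "\<exists>!L. lax_solution (monomial_path A) L0 L"
    proof (rule ex1I)
      show "lax_solution (monomial_path A) L0
          (\<lambda>t. dyson_series A t * fps_const L0 * inverse_dyson_series A t)"
        by (rule sol)
      show "L = (\<lambda>t. dyson_series A t * fps_const L0 * inverse_dyson_series A t)"
        if "lax_solution (monomial_path A) L0 L" for L
        using that sol by (rule lax_solution_unique[OF A])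
    qed
    fix L t assume "lax_solution (monomial_path A) L0 L"
    then have L: "L = (\<lambda>t. dyson_series A t * fps_const L0 * inverse_dyson_series A t)"
      using sol by (rule lax_solution_unique[OF A])
    show "\<exists>E'. dyson_series A t * E' = 1 \<and> E' * dyson_series A t = 1 \<and>
        L t = dyson_series A t * fps_const L0 * E'"
      using dyson_series_mult_inverse_dyson_series[OF A]
        inverse_dyson_series_mult_dyson_series[OF A] by (auto simp: L)
  qed
qed

end
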